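(* Let $\Lambda^\star=\Pi_{\mathbb{S}_1\cap\mathbb{S}_2}(\bar\Lambda)$, where $\mathbb{S}_1=\{\Lambda:\mathrm{Diag}(\Lambda)\le0\}$ and $\mathbb{S}_2=\{\Lambda:I-\Lambda\in\mathbb{S}_+\}$, and assume that $\bar\Lambda-\Lambda^\star$ resides in the relative interior of the normal cone of $\mathbb{S}_1\cap\mathbb{S}_2$, i.e. $\bar\Lambda-\Lambda^\star\in\mathrm{rint}\big(\mathcal{N}_{\mathbb{S}_1\cap\mathbb{S}_2}(\Lambda^\star)\big)$. Then Dykstra's projection algorithm (described in the context) converges linearly to $\Lambda^\star$ from any initial point.
   Context: All matrices are real symmetric $n\times n$, and $\bar\Lambda$ is a given symmetric matrix. $\mathbb{S}_+$ is the cone of positive semidefinite matrices, $\langle A,B\rangle=\operatorname{Tr}(A^\top B)$, and $\|\cdot\|_F$ is the Frobenius norm. $\mathrm{Diag}(A)\le0$ means that all diagonal entries of $A$ are non-positive. $\Pi_{\mathbb{A}}[x]=\arg\min_{y\in\mathbb{A}}\|x-y\|_F^2$ is the orthogonal projection. The normal cone of a set $\mathbb{A}$ at $x$ is $\mathcal{N}_{\mathbb{A}}(x)=\{v:\langle v,y-x\rangle\le0\ \ \forall y\in\mathbb{A}\}$, and $\mathrm{rint}$ denotes the relative interior. Dykstra's projection algorithm for computing $\Pi_{\mathbb{S}_1\cap\mathbb{S}_2}[\Lambda]$ takes as input $U_2^0=\Lambda$, $Z_1^0=0$, $Z_2^0=0$ and a threshold $\epsilon$, and, while $\|U_2^k-U_1^k\|_F/\|U_2^k\|_F\ge\epsilon$,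 iterates over $k$ $$U_1^k=\Pi_{\mathbb{S}_1}[U_2^{k-1}+Z_1^{k-1}],\quad Z_1^k=U_2^{k-1}+Z_1^{k-1}-U_1^k,\quad U_2^k=\Pi_{\mathbb{S}_2}[U_1^k+Z_2^{k-1}],\quad Z_2^k=U_1^k+Z_2^{k-1}-U_2^k,$$ and returns $U_2^k$. Linear convergence means convergence at an exponential rate in $k$.
   Formalization: "From any initial point" is read as: the algorithm starts at U_2^0 = Λ̄ (with Z_1^0 = Z_2^0 = 0), for every admissible Λ̄; with U_2^0 unrelated to Λ̄ the claim fails (n=1, Λ̄=1, Λ*=0, start −1: all iterates stay at −1). *)

theory Defs
  imports "HOL-Analysis.Analysis"
begin

text \<open>
  The ambient space is the space of symmetric matrices, a subspace of the type of all square
  matrices, whose inner product and norm are the Frobenius ones: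
\<close>

lemma inner_matrix_eq_trace:
  fixes A B :: "real^'n^'n"
  shows "A \<bullet> B = trace (transpose A ** B)"
  unfolding inner_vec_def trace_def matrix_matrix_mult_def transpose_def
  by (simp, subst sum.swap, simp)

lemma norm_matrix_eq_frobenius:
  fixes A :: "real^'n^'n"
  shows "norm A = sqrt (trace (transpose A ** A))"
  by (simp add: norm_eq_sqrt_inner inner_matrix_eq_trace)

definition symmetric_matrices :: "(real^'n^'n) set" where
  "symmetric_matrices = {A. transpose A = A}"

definition psd_cone :: "(real^'n^'n) set" where
  "psd_cone = {A \<in> symmetric_matrices. \<forall>x. 0 \<le> x \<bullet> (A *v x)}"

definition diag_nonpos :: "(real^'n^'n) set" where
  "diag_nonpos = {L \<in> symmetric_matrices. \<forall>i. L $ i $ i \<le> 0}"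

definition below_identity :: "(real^'n^'n) set" where
  "below_identity = {L \<in> symmetric_matrices. mat 1 - L \<in> psd_cone}"

text \<open>
  The normal vectors are taken within the ambient space of symmetric matrices; without this
  restriction the cone would contain every antisymmetric matrix.
\<close>

definition normal_cone :: "(real^'n^'n) set \<Rightarrow> real^'n^'n \<Rightarrow> (real^'n^'n) set" where
  "normal_cone A x = {v \<in> symmetric_matrices. \<forall>y\<in>A. v \<bullet> (y - x) \<le> 0}"

text \<open>
  The full, untruncated sequence generated by Dykstra's algorithm: stopping at a threshold
  \<open>\<epsilon>\<close> returns one of the iterates \<open>U2 k\<close>. The recursion does not use \<open>U1 0\<close>, which is arbitrary.
\<close>

definition dykstra_iterates ::
  "(real^'n^'n) set \<Rightarrow> (real^'n^'n) set \<Rightarrow> real^'n^'n \<Rightarrow>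
   (nat \<Rightarrow> real^'n^'n) \<Rightarrow> (nat \<Rightarrow> real^'n^'n) \<Rightarrow> (nat \<Rightarrow> real^'n^'n) \<Rightarrow> (nat \<Rightarrow> real^'n^'n) \<Rightarrow> bool"
where
  "dykstra_iterates S1 S2 L U1 Z1 U2 Z2 \<longleftrightarrow>
     U2 0 = L \<and> Z1 0 = 0 \<and> Z2 0 = 0 \<and>
     (\<forall>k. U1 (Suc k) = closest_point S1 (U2 k + Z1 k) \<and>
          Z1 (Suc k) = U2 k + Z1 k - U1 (Suc k) \<and>
          U2 (Suc k) = closest_point S2 (U1 (Suc k) + Z2 k) \<and>
          Z2 (Suc k) = U1 (Suc k) + Z2 k - U2 (Suc k))"

definition converges_linearly :: "(nat \<Rightarrow> 'a::real_normed_vector) \<Rightarrow> 'a \<Rightarrow> bool" where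
  "converges_linearly X l \<longleftrightarrow>
     (\<exists>C \<rho>. 0 < \<rho> \<and> \<rho> < 1 \<and> (\<forall>k. norm (X k - l) \<le> C * \<rho> ^ k))"

end

theory Submission
  imports Defs
begin

text \<open>
  Write \<open>S\<^sub>1\<close> and \<open>S\<^sub>2\<close> for the constraints \<open>diag L \<le> 0\<close> and \<open>L \<le> I\<close>. Each projection splits its
  argument into a feasible point and a normal vector, and the correction terms \<open>Z1\<close>, \<open>Z2\<close> are these
  normal vectors. Since \<open>U2 k + Z1 k + Z2 k = L\<close> throughout, the iteration is an alternating map on the
  pair \<open>(Z1, Z2)\<close>, and the claim is that this map contracts towards multipliers \<open>(D, Z)\<close> of the
  projection problem, i.e. normal vectors to \<open>S\<^sub>1\<close> and \<open>S\<^sub>2\<close> at a common point \<open>U\<close> with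
  \<open>L = U + D + Z\<close>; such a \<open>U\<close> is the projection of \<open>L\<close>.

  Multipliers exist (\<open>multipliers_exist\<close>) because the dual objective
  \<open>\<parallel>L - D - Z\<parallel>\<^sup>2 / 2 + tr Z\<close> attains its minimum over \<open>D \<ge> 0\<close> diagonal and \<open>Z \<ge> 0\<close>: it is coercive, as
  the trace dominates the norm on positive semidefinite matrices.

  The map from an argument to its projection residual is nonexpansive, so neither half step increases
  the error. The half step for \<open>S\<^sub>2\<close> decreases it by a fixed factor (\<open>psd_residual_contraction\<close>). Let
  \<open>W = Z1 (k+1) - D\<close> be the error that enters it and \<open>Y = I - U\<close> the slack. The matrix \<open>W\<close> is
  diagonal, and \<open>Y\<^sub>i\<^sub>i \<ge> 1\<close> because \<open>U\<^sub>i\<^sub>i \<le> 0\<close>; therefore \<open>\<parallel>W\<parallel> \<le> \<parallel>Y W\<parallel>\<close>. On the other hand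
  complementarity gives \<open>Y Z = 0\<close>, so up to sign \<open>Y W\<close> is \<open>Y Z' + Y (U' - U)\<close>, where \<open>(U', Z')\<close> is
  the outcome of the half step. Both summands are controlled by what the half step loses,
  \<open>\<parallel>W\<parallel>\<^sup>2 - \<parallel>Z' - Z\<parallel>\<^sup>2 \<ge> \<parallel>U' - U\<parallel>\<^sup>2 + 2 \<langle>Z', Y\<rangle>\<close>, thanks to the estimate
  \<open>\<parallel>Y Z'\<parallel>\<^sup>2 \<le> \<parallel>Y\<parallel> \<parallel>Z'\<parallel> \<langle>Z', Y\<rangle>\<close> for positive semidefinite matrices (\<open>psd_product_norm_le\<close>). So the loss
  is at least a fixed fraction of \<open>\<parallel>W\<parallel>\<^sup>2\<close>, uniformly in \<open>k\<close> because \<open>\<parallel>Z'\<parallel>\<close> stays bounded.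
\<close>

section \<open>Frobenius estimates\<close>

lemma norm_matrix_power2_eq_sum_rows:
  fixes A :: "real^'n^'m"
  shows "(norm A)\<^sup>2 = (\<Sum>i\<in>UNIV. (norm (A $ i))\<^sup>2)"
  unfolding power2_norm_eq_inner by (rule inner_vec_def)

lemma norm_matrix_vector_mult_le:
  fixes A :: "real^'n^'m"
  shows "norm (A *v x) \<le> norm A * norm x"
proof (rule power2_le_imp_le)
  have "(norm (A *v x))\<^sup>2 = (\<Sum>i\<in>UNIV. (A $ i \<bullet> x)\<^sup>2)"
    unfolding power2_norm_eq_inner inner_vec_def[of "A *v x"]
    by (simp add: matrix_vector_mul_component power2_eq_square)
  also have "\<dots> \<le> (\<Sum>i\<in>UNIV. (norm (A $ i))\<^sup>2 * (norm x)\<^sup>2)"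
    by (intro sum_mono) (metis Cauchy_Schwarz_ineq power2_norm_eq_inner)
  also have "\<dots> = (norm A * norm x)\<^sup>2"
    by (simp add: norm_matrix_power2_eq_sum_rows power_mult_distrib sum_distrib_right)
  finally show "(norm (A *v x))\<^sup>2 \<le> (norm A * norm x)\<^sup>2" .
qed simp

lemma row_matrix_matrix_mult:
  fixes A :: "real^'n^'m" and B :: "real^'k^'n"
  shows "(A ** B) $ i = transpose B *v (A $ i)"
  by (simp add: vec_eq_iff matrix_matrix_mult_def vector_matrix_mult_def mult.commute)

lemma norm_matrix_matrix_mult_le:
  fixes A B :: "real^'n^'n"
  shows "norm (A ** B) \<le> norm A * norm B"
proof (rule power2_le_imp_le)
  have "norm (transpose B) = norm B"
    by (metis norm_matrix_eq_frobenius trace_mul_sym transpose_transpose)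
  then have "norm ((A ** B) $ i) \<le> norm B * norm (A $ i)" for i
    by (metis norm_matrix_vector_mult_le row_matrix_matrix_mult)
  then have "(norm ((A ** B) $ i))\<^sup>2 \<le> (norm B)\<^sup>2 * (norm (A $ i))\<^sup>2" for i
    by (metis norm_ge_zero power_mono power_mult_distrib)
  then have "(\<Sum>i\<in>UNIV. (norm ((A ** B) $ i))\<^sup>2) \<le> (\<Sum>i\<in>UNIV. (norm B)\<^sup>2 * (norm (A $ i))\<^sup>2)"
    by (intro sum_mono)
  then show "(norm (A ** B))\<^sup>2 \<le> (norm A * norm B)\<^sup>2"
    by (simp only: norm_matrix_power2_eq_sum_rows[of "A ** B"] norm_matrix_power2_eq_sum_rows[of A]
        power_mult_distrib mult.commute[of _ "(norm B)\<^sup>2"] sum_distrib_left)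
qed simp

section \<open>Symmetric and positive semidefinite matrices\<close>

lemma subspace_symmetric_matrices: "subspace symmetric_matrices"
  by (auto simp: subspace_def symmetric_matrices_def transpose_def vec_eq_iff)

lemmas symmetric_matrices_closure =
  subspace_add[OF subspace_symmetric_matrices] subspace_diff[OF subspace_symmetric_matrices]
  subspace_scale[OF subspace_symmetric_matrices] subspace_0[OF subspace_symmetric_matrices]

lemma mat_1_symmetric: "mat 1 \<in> symmetric_matrices"
  by (simp add: symmetric_matrices_def)

lemma symmetric_matrix_component: "A \<in> symmetric_matrices \<Longrightarrow> A $ i $ j = A $ j $ i"
  by (metis (mono_tags) mem_Collect_eq symmetric_matrices_def transpose_def vec_lambda_beta)

lemma square_symmetric: "A \<in> symmetric_matrices \<Longrightarrow> A ** A \<in> symmetric_matrices"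
  by (simp add: symmetric_matrices_def matrix_transpose_mul)

lemma psd_cone_symmetric: "A \<in> psd_cone \<Longrightarrow> A \<in> symmetric_matrices"
  and psd_cone_form: "A \<in> psd_cone \<Longrightarrow> 0 \<le> x \<bullet> (A *v x)"
  by (auto simp: psd_cone_def)

lemma psd_coneI:
  "A \<in> symmetric_matrices \<Longrightarrow> (\<And>x. 0 \<le> x \<bullet> (A *v x)) \<Longrightarrow> A \<in> psd_cone"
  by (simp add: psd_cone_def)

definition outer_square :: "real^'n \<Rightarrow> real^'n^'n" where
  "outer_square x = (\<chi> i j. x $ i * x $ j)"

lemma outer_square_symmetric: "outer_square x \<in> symmetric_matrices"
  by (simp add: outer_square_def symmetric_matrices_def transpose_def mult.commute)

lemma inner_outer_square: "A \<bullet> outer_square x = x \<bullet> (A *v x)"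
  by (simp add: outer_square_def inner_vec_def matrix_vector_mult_def sum_distrib_left
      mult.commute mult.left_commute)

lemma outer_square_psd: "outer_square x \<in> psd_cone"
proof (intro psd_coneI outer_square_symmetric)
  fix y
  have "outer_square x *v y = (x \<bullet> y) *\<^sub>R x"
    by (simp add: outer_square_def inner_vec_def matrix_vector_mult_def vec_eq_iff
        sum_distrib_left sum_distrib_right mult_ac)
  then have "y \<bullet> (outer_square x *v y) = (x \<bullet> y)\<^sup>2"
    by (simp add: power2_eq_square inner_commute)
  then show "0 \<le> y \<bullet> (outer_square x *v y)" by simp
qed

lemma symmetric_form_vector:
  assumes "A \<in> symmetric_matrices"
  shows "x \<bullet> (A *v y) = (A *v x) \<bullet> y"
proof -
  have "A *v x = x v* A"
    using assms transpose_matrix_vector[of A x] by (simp add: symmetric_matrices_def)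
  then show ?thesis by (simp add: dot_lmul_matrix)
qed

lemma norm_mat_1_minus_psd:
  assumes "A \<in> symmetric_matrices"
  shows "norm A *\<^sub>R mat 1 - A \<in> psd_cone"
proof (intro psd_coneI symmetric_matrices_closure mat_1_symmetric assms)
  fix x :: "real^'a"
  have "x \<bullet> (A *v x) \<le> norm x * norm (A *v x)" by (rule norm_cauchy_schwarz)
  also have "\<dots> \<le> norm x * (norm A * norm x)"
    by (intro mult_left_mono norm_matrix_vector_mult_le) simp
  finally have "x \<bullet> (A *v x) \<le> norm A * (x \<bullet> x)"
    by (simp add: mult_ac power2_eq_square dot_square_norm)
  then show "0 \<le> x \<bullet> ((norm A *\<^sub>R mat 1 - A) *v x)"
    by (simp add: matrix_vector_mult_diff_rdistrib inner_diff_right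
        flip: scaleR_matrix_vector_assoc)
qed

text \<open>
  This is the spectral fact \<open>A\<^sup>2 \<le> \<parallel>A\<parallel> A\<close>, obtained without diagonalising \<open>A\<close>: evaluate the nonnegative
  form at the gradient step \<open>x - A x / \<parallel>A\<parallel>\<close>.
\<close>

lemma psd_norm_image_le:
  assumes A: "A \<in> psd_cone"
  shows "(norm (A *v x))\<^sup>2 \<le> norm A * (x \<bullet> (A *v x))"
proof (cases "A = 0")
  case False
  define w where "w = A *v x"
  define s where "s = 1 / norm A"
  have s: "s > 0" "s * norm A = 1" using False by (auto simp: s_def)
  have "0 \<le> (x - s *\<^sub>R w) \<bullet> (A *v (x - s *\<^sub>R w))"
    by (rule psd_cone_form[OF A])
  also have "\<dots> = x \<bullet> w - 2 * s * (norm w)\<^sup>2 + s\<^sup>2 * (w \<bullet> (A *v w))"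
  proof -
    have "A *v (x - s *\<^sub>R w) = w - s *\<^sub>R (A *v w)"
      by (simp add: w_def matrix_vector_mult_diff_distrib matrix_vector_mult_scaleR)
    moreover have "x \<bullet> (A *v w) = w \<bullet> w"
      using symmetric_form_vector[OF psd_cone_symmetric[OF A], of x w] by (simp flip: w_def)
    ultimately show ?thesis
      by (simp add: inner_diff_left inner_diff_right power2_norm_eq_inner power2_eq_square[of s]
          right_diff_distrib)
  qed
  also have "\<dots> \<le> x \<bullet> w - 2 * s * (norm w)\<^sup>2 + s\<^sup>2 * (norm A * (norm w)\<^sup>2)"
  proof -
    have "w \<bullet> (A *v w) \<le> norm w * norm (A *v w)" by (rule norm_cauchy_schwarz)
    also have "\<dots> \<le> norm w * (norm A * norm w)"
      by (intro mult_left_mono norm_matrix_vector_mult_le) simp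
    finally have "w \<bullet> (A *v w) \<le> norm A * (norm w)\<^sup>2"
      by (simp add: power2_eq_square mult_ac)
    then show ?thesis by (intro add_left_mono mult_left_mono) auto
  qed
  also have "s\<^sup>2 * (norm A * (norm w)\<^sup>2) = s * (norm w)\<^sup>2"
  proof -
    have "s\<^sup>2 * (norm A * (norm w)\<^sup>2) = (s * norm A) * (s * (norm w)\<^sup>2)"
      by (simp add: power2_eq_square[of s])
    then show ?thesis by (simp add: s(2))
  qed
  finally have "s * (norm w)\<^sup>2 \<le> x \<bullet> w" by simp
  then have "norm A * (s * (norm w)\<^sup>2) \<le> norm A * (x \<bullet> w)"
    by (intro mult_left_mono) auto
  moreover have "norm A * (s * (norm w)\<^sup>2) = (s * norm A) * (norm w)\<^sup>2" by simp
  ultimately show ?thesis by (simp add: s(2) flip: w_def)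
qed simp

lemma norm_scaled_minus_square_psd:
  assumes A: "A \<in> psd_cone"
  shows "norm A *\<^sub>R A - A ** A \<in> psd_cone"
proof (rule psd_coneI)
  show "norm A *\<^sub>R A - A ** A \<in> symmetric_matrices"
    using psd_cone_symmetric[OF A] by (intro symmetric_matrices_closure square_symmetric)
  fix x
  have "x \<bullet> ((A ** A) *v x) = (norm (A *v x))\<^sup>2"
    unfolding power2_norm_eq_inner matrix_vector_mul_assoc[symmetric]
    by (rule symmetric_form_vector[OF psd_cone_symmetric[OF A]])
  then show "0 \<le> x \<bullet> ((norm A *\<^sub>R A - A ** A) *v x)"
    using psd_norm_image_le[OF A, of x]
    by (simp add: matrix_vector_mult_diff_rdistrib inner_diff_right
        flip: scaleR_matrix_vector_assoc)
qed

text \<open>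
  The positive semidefinite cone is its own dual cone. The dual description is the one in which normal
  vectors to \<open>S\<^sub>2\<close> arise, and it gives the sign of their inner products with slack matrices at once;
  testing with \<open>x x\<^sup>T\<close> recovers the quadratic form (\<open>psd_dual_psd\<close>).
\<close>

definition psd_dual :: "(real^'n^'n) set" where
  "psd_dual = {Z \<in> symmetric_matrices. \<forall>P\<in>psd_cone. 0 \<le> Z \<bullet> P}"

lemma psd_dual_symmetric: "Z \<in> psd_dual \<Longrightarrow> Z \<in> symmetric_matrices"
  and psd_dual_inner: "Z \<in> psd_dual \<Longrightarrow> P \<in> psd_cone \<Longrightarrow> 0 \<le> Z \<bullet> P"
  by (auto simp: psd_dual_def)

lemma psd_dual_psd: "Z \<in> psd_dual \<Longrightarrow> Z \<in> psd_cone"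
  using psd_dual_inner[OF _ outer_square_psd]
  by (intro psd_coneI psd_dual_symmetric) (auto simp: inner_outer_square)

lemma outer_square_psd_dual: "outer_square x \<in> psd_dual"
  by (simp add: psd_dual_def outer_square_symmetric inner_commute[of "outer_square x"]
      inner_outer_square psd_cone_form)

text \<open>
  The bound makes the dual objective coercive. It follows from testing \<open>Z\<close> against \<open>\<parallel>Z\<parallel> I - Z\<close>.
\<close>

lemma psd_dual_norm_le_trace:
  assumes "Z \<in> psd_dual"
  shows "norm Z \<le> Z \<bullet> mat 1"
proof (cases "Z = 0")
  case False
  have "0 \<le> Z \<bullet> (norm Z *\<^sub>R mat 1 - Z)"
    by (intro psd_dual_inner assms norm_mat_1_minus_psd psd_dual_symmetric)
  then have "norm Z * norm Z \<le> norm Z * (Z \<bullet> mat 1)"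
    by (simp add: inner_diff_right power2_norm_eq_inner flip: power2_eq_square)
  with False show ?thesis by simp
qed simp

text \<open>
  A quantitative form of the fact that \<open>\<langle>Z, Y\<rangle> = 0\<close> forces \<open>Y Z = 0\<close>. In trace notation it applies
  \<open>A\<^sup>2 \<le> \<parallel>A\<parallel> A\<close> to both factors: \<open>tr (Y Z\<^sup>2 Y) \<le> \<parallel>Z\<parallel> tr (Z Y\<^sup>2) \<le> \<parallel>Z\<parallel> \<parallel>Y\<parallel> tr (Z Y)\<close>.
  Its right side is linear in \<open>\<langle>Z, Y\<rangle>\<close> while its left side is quadratic in \<open>Y Z\<close>, which is
  the scaling that yields a linear rate.
\<close>

lemma psd_product_norm_le:
  assumes Y: "Y \<in> psd_cone" and Z: "Z \<in> psd_dual"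
  shows "(norm (Y ** Z))\<^sup>2 \<le> norm Y * norm Z * (Z \<bullet> Y)"
proof -
  have "transpose Z = Z" using psd_dual_symmetric[OF Z] by (simp add: symmetric_matrices_def)
  then have "(norm (Y ** Z))\<^sup>2 = (\<Sum>i\<in>UNIV. (norm (Z *v (Y $ i)))\<^sup>2)"
    by (simp only: norm_matrix_power2_eq_sum_rows row_matrix_matrix_mult)
  also have "\<dots> \<le> (\<Sum>i\<in>UNIV. norm Z * (Y $ i \<bullet> (Z *v (Y $ i))))"
    by (intro sum_mono psd_norm_image_le psd_dual_psd Z)
  also have "\<dots> = norm Z * (\<Sum>i\<in>UNIV. Z \<bullet> outer_square (Y $ i))"
    by (simp only: sum_distrib_left inner_outer_square)
  also have "(\<Sum>i\<in>UNIV. Z \<bullet> outer_square (Y $ i)) = Z \<bullet> (Y ** Y)"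
  proof -
    have "Y ** Y = (\<Sum>i\<in>UNIV. outer_square (Y $ i))"
      using symmetric_matrix_component[OF psd_cone_symmetric[OF Y]]
      by (simp add: vec_eq_iff matrix_matrix_mult_def outer_square_def)
    then show ?thesis by (simp add: inner_sum_right)
  qed
  also have "norm Z * (Z \<bullet> (Y ** Y)) \<le> norm Z * (norm Y * (Z \<bullet> Y))"
    using psd_dual_inner[OF Z norm_scaled_minus_square_psd[OF Y]]
    by (intro mult_left_mono) (auto simp: inner_diff_right)
  finally show ?thesis by (simp add: mult_ac)
qed

section \<open>The two constraint sets and their normal cones\<close>

lemma closed_symmetric_matrices: "closed symmetric_matrices"
  by (rule closed_subspace[OF subspace_symmetric_matrices])

lemma closed_psd_cone: "closed (psd_cone :: (real^'n^'n) set)"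
proof -
  have eq: "(psd_cone :: (real^'n^'n) set) = symmetric_matrices \<inter> (\<Inter>x. {A. 0 \<le> A \<bullet> outer_square x})"
    by (auto simp: psd_cone_def inner_outer_square)
  have cl: "closed {A. 0 \<le> A \<bullet> outer_square x}" for x :: "real^'n"
    by (intro closed_Collect_le continuous_intros)
  show ?thesis
    unfolding eq by (intro closed_Int closed_symmetric_matrices closed_INT ballI cl)
qed

lemma convex_psd_cone: "convex psd_cone"
  by (auto simp: convex_def psd_cone_def symmetric_matrices_closure inner_add_right
      matrix_vector_mult_add_rdistrib simp flip: scaleR_matrix_vector_assoc)

lemma below_identity_iff:
  "L \<in> below_identity \<longleftrightarrow> mat 1 - L \<in> psd_cone"
proof -
  have "L \<in> symmetric_matrices" if "mat 1 - L \<in> psd_cone"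
    using symmetric_matrices_closure(2)[OF mat_1_symmetric psd_cone_symmetric[OF that]] by simp
  then show ?thesis by (auto simp: below_identity_def)
qed

lemma below_identity_eq: "below_identity = (\<lambda>P. mat 1 - P) ` psd_cone"
  by (force simp: below_identity_iff image_iff)

lemma closed_below_identity: "closed (below_identity :: (real^'n^'n) set)"
proof -
  have eq: "(below_identity :: (real^'n^'n) set) = (\<lambda>L. mat 1 - L) -` psd_cone"
    by (auto simp: below_identity_iff)
  show ?thesis
    unfolding eq by (intro closed_vimage closed_psd_cone continuous_intros)
qed

lemma convex_below_identity: "convex (below_identity :: (real^'n^'n) set)"
proof -
  have eq: "(below_identity :: (real^'n^'n) set) = (+) (mat 1) ` (\<lambda>P. - P) ` psd_cone"
    by (auto simp: below_identity_eq image_image)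
  show ?thesis
    unfolding eq by (intro convex_translation convex_negations convex_psd_cone)
qed

lemma closed_diag_nonpos: "closed (diag_nonpos :: (real^'n^'n) set)"
proof -
  have eq: "(diag_nonpos :: (real^'n^'n) set) = symmetric_matrices \<inter> (\<Inter>i. {L. L $ i $ i \<le> 0})"
    by (auto simp: diag_nonpos_def)
  have cl: "closed {L :: real^'n^'n. L $ i $ i \<le> 0}" for i
    by (intro closed_Collect_le continuous_intros)
  show ?thesis
    unfolding eq by (intro closed_Int closed_symmetric_matrices closed_INT ballI cl)
qed

lemma diag_nonpos_add: "K \<in> diag_nonpos \<Longrightarrow> L \<in> diag_nonpos \<Longrightarrow> K + L \<in> diag_nonpos"
  and diag_nonpos_scaleR: "0 \<le> c \<Longrightarrow> L \<in> diag_nonpos \<Longrightarrow> c *\<^sub>R L \<in> diag_nonpos"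
  by (auto simp: diag_nonpos_def symmetric_matrices_closure add_nonpos_nonpos
      mult_nonneg_nonpos)

lemma convex_diag_nonpos: "convex diag_nonpos"
  by (auto simp: convex_def diag_nonpos_add diag_nonpos_scaleR)

lemma zero_feasible: "0 \<in> diag_nonpos" "0 \<in> below_identity"
  by (auto simp: diag_nonpos_def below_identity_iff symmetric_matrices_closure psd_cone_def
      mat_1_symmetric)

text \<open>
  Normal vectors to \<open>S\<^sub>2\<close> are dual to the cone and complementary to the slack, because \<open>S\<^sub>2\<close> is the
  cone reflected and moved to \<open>I\<close>: from \<open>U\<close> one may subtract any positive semidefinite \<open>P\<close>, and move
  along the ray from \<open>I\<close> through \<open>U\<close> in both directions.
\<close>

lemma below_identity_normalD:
  assumes Z: "Z \<in> normal_cone below_identity U" and U: "U \<in> below_identity"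
  shows "Z \<in> psd_dual" "Z \<bullet> (mat 1 - U) = 0"
proof -
  have sym: "Z \<in> symmetric_matrices" and le: "Z \<bullet> (mat 1 - P - U) \<le> 0" if "P \<in> psd_cone" for P
    using Z that by (auto simp: normal_cone_def below_identity_eq)
  have Y: "mat 1 - U \<in> psd_cone" using U by (simp add: below_identity_iff)
  have cone: "c *\<^sub>R (mat 1 - U) + P \<in> psd_cone" if "0 \<le> c" "P \<in> psd_cone" for c P
    using that Y by (auto simp: psd_cone_def symmetric_matrices_closure inner_add_right
        matrix_vector_mult_add_rdistrib simp flip: scaleR_matrix_vector_assoc)
  have zero: "0 \<in> psd_cone" by (simp add: psd_cone_def symmetric_matrices_closure)
  have "0 \<le> Z \<bullet> P" if "P \<in> psd_cone" for P
    using le[OF cone[of 1 P]] that by (simp add: inner_diff_right inner_add_right)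
  then show "Z \<in> psd_dual" using sym[OF zero] by (simp add: psd_dual_def)
  have "Z \<bullet> (mat 1 - U) \<le> 0" using le[OF zero] by simp
  moreover have "0 \<le> Z \<bullet> (mat 1 - U)"
    using le[OF cone[OF _ zero, of 2]] by (simp add: inner_diff_right algebra_simps)
  ultimately show "Z \<bullet> (mat 1 - U) = 0" by simp
qed

lemma below_identity_normalI:
  assumes "Z \<in> psd_dual" "Z \<bullet> (mat 1 - U) \<le> 0"
  shows "Z \<in> normal_cone below_identity U"
  using assms
  by (auto simp: normal_cone_def below_identity_eq psd_dual_symmetric inner_diff_right
      dest: psd_dual_inner)

text \<open>
  \<open>S\<^sub>1\<close> does not restrict the off-diagonal entries, so symmetric off-diagonal perturbations are feasible
  with either sign.
\<close>

lemma diag_nonpos_normal_off_diagonal: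
  assumes D: "D \<in> normal_cone diag_nonpos U" and U: "U \<in> diag_nonpos" and ij: "i \<noteq> j"
  shows "D $ i $ j = 0"
proof -
  define E :: "real^'a^'a" where "E = axis i (axis j 1) + axis j (axis i 1)"
  have "E \<in> symmetric_matrices"
    by (auto simp: E_def symmetric_matrices_def transpose_def vec_eq_iff axis_def)
  moreover have "E $ k $ k = 0" for k
    using ij by (auto simp: E_def axis_def)
  ultimately have "c *\<^sub>R E + U \<in> diag_nonpos" for c
    using U by (auto simp: diag_nonpos_def symmetric_matrices_closure)
  then have "D \<bullet> (c *\<^sub>R E + U - U) \<le> 0" for c
    using D by (auto simp only: normal_cone_def mem_Collect_eq)
  from this[of 1] this[of "-1"] have "D \<bullet> E = 0" by simp
  moreover have "D \<bullet> E = D $ i $ j + D $ j $ i"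
    by (simp add: E_def inner_add_right inner_axis)
  moreover have "D $ i $ j = D $ j $ i"
    using D by (intro symmetric_matrix_component) (simp add: normal_cone_def)
  ultimately show ?thesis by simp
qed

section \<open>Projections and normal vectors\<close>

lemma closest_point_residual_normal:
  fixes A :: "real^'n^'n"
  assumes "convex S" "closed S" "S \<noteq> {}" "S \<subseteq> symmetric_matrices" "A \<in> symmetric_matrices"
  shows "closest_point S A \<in> S" "A - closest_point S A \<in> normal_cone S (closest_point S A)"
proof -
  show "closest_point S A \<in> S" using assms by (simp add: closest_point_in_set)
  then show "A - closest_point S A \<in> normal_cone S (closest_point S A)"
    using assms by (auto simp: normal_cone_def symmetric_matrices_closure closest_point_dot)
qed

lemma closest_point_eqI:
  fixes A :: "real^'n^'n"
  assumes "convex S" "closed S" "U \<in> S" "A - U \<in> normal_cone S U"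
  shows "closest_point S A = U"
proof (rule closest_point_unique[OF assms(1-3), symmetric], rule ballI)
  fix V assume "V \<in> S"
  then have "(A - U) \<bullet> (V - U) \<le> 0" using assms(4) by (simp add: normal_cone_def)
  then have "(norm (A - U))\<^sup>2 \<le> (norm (A - V))\<^sup>2"
    using inner_ge_zero[of "V - U"]
    by (simp add: power2_norm_eq_inner algebra_simps inner_commute)
  then show "dist A U \<le> dist A V" unfolding dist_norm by (rule power2_le_imp_le) simp
qed

lemma normal_cone_monotone:
  assumes "U \<in> S" "V \<in> S" "P \<in> normal_cone S U" "Q \<in> normal_cone S V"
  shows "0 \<le> (P - Q) \<bullet> (U - V)"
proof -
  have "P \<bullet> (V - U) \<le> 0" "Q \<bullet> (U - V) \<le> 0" using assms by (auto simp: normal_cone_def)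
  then show ?thesis by (simp add: inner_diff_left inner_diff_right)
qed

lemma residual_nonexpansive:
  assumes "U \<in> S" "V \<in> S" "P \<in> normal_cone S U" "Q \<in> normal_cone S V"
  shows "norm (P - Q) \<le> norm ((U + P) - (V + Q))"
proof (rule power2_le_imp_le)
  have "(norm ((U + P) - (V + Q)))\<^sup>2
      = (norm (P - Q))\<^sup>2 + (norm (U - V))\<^sup>2 + 2 * ((P - Q) \<bullet> (U - V))"
    by (simp add: power2_norm_eq_inner algebra_simps inner_commute)
  then show "(norm (P - Q))\<^sup>2 \<le> (norm ((U + P) - (V + Q)))\<^sup>2"
    using normal_cone_monotone[OF assms] by simp
qed simp

section \<open>Existence of multipliers\<close>

definition diag_polar :: "(real^'n^'n) set" where
  "diag_polar = {D \<in> symmetric_matrices. \<forall>L\<in>diag_nonpos. D \<bullet> L \<le> 0}"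

lemma closed_diag_polar: "closed (diag_polar :: (real^'n^'n) set)"
proof -
  have eq: "(diag_polar :: (real^'n^'n) set) = symmetric_matrices \<inter> (\<Inter>L\<in>diag_nonpos. {D. D \<bullet> L \<le> 0})"
    by (auto simp: diag_polar_def)
  have cl: "closed {D. D \<bullet> L \<le> 0}" for L :: "real^'n^'n"
    by (intro closed_Collect_le continuous_intros)
  show ?thesis
    unfolding eq by (intro closed_Int closed_symmetric_matrices closed_INT ballI cl)
qed

lemma closed_psd_dual: "closed (psd_dual :: (real^'n^'n) set)"
proof -
  have eq: "(psd_dual :: (real^'n^'n) set) = symmetric_matrices \<inter> (\<Inter>P\<in>psd_cone. {Z. 0 \<le> Z \<bullet> P})"
    by (auto simp: psd_dual_def)
  have cl: "closed {Z. 0 \<le> Z \<bullet> P}" for P :: "real^'n^'n"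
    by (intro closed_Collect_le continuous_intros)
  show ?thesis
    unfolding eq by (intro closed_Int closed_symmetric_matrices closed_INT ballI cl)
qed

lemma diag_polar_add_scaleR:
  "0 \<le> c \<Longrightarrow> D \<in> diag_polar \<Longrightarrow> E \<in> diag_polar \<Longrightarrow> D + c *\<^sub>R E \<in> diag_polar"
  by (auto simp: diag_polar_def symmetric_matrices_closure inner_add_left add_nonpos_nonpos
      mult_nonneg_nonpos)

lemma psd_dual_add_scaleR:
  "0 \<le> c \<Longrightarrow> Z \<in> psd_dual \<Longrightarrow> Q \<in> psd_dual \<Longrightarrow> Z + c *\<^sub>R Q \<in> psd_dual"
  by (auto simp: psd_dual_def symmetric_matrices_closure inner_add_left)

text \<open>
  The Lagrange dual of the projection problem, with the sign changed and up to a constant. On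
  \<open>psd_dual\<close> the trace term is the support function of \<open>S\<^sub>2\<close>; that of the cone \<open>S\<^sub>1\<close> vanishes on its polar.
\<close>

definition dual_objective :: "real^'n^'n \<Rightarrow> (real^'n^'n) \<times> (real^'n^'n) \<Rightarrow> real" where
  "dual_objective L = (\<lambda>(D, Z). (norm (L - D - Z))\<^sup>2 / 2 + Z \<bullet> mat 1)"

lemma dual_minimum_exists:
  obtains D Z where "D \<in> diag_polar" "Z \<in> psd_dual"
    "\<And>D' Z'. D' \<in> diag_polar \<Longrightarrow> Z' \<in> psd_dual \<Longrightarrow>
       dual_objective L (D, Z) \<le> dual_objective L (D', Z')"
proof -
  define c where "c = dual_objective L (0, 0)"
  define K where "K = (diag_polar \<times> psd_dual) \<inter> {p. dual_objective L p \<le> c}"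
  have zero: "(0, 0) \<in> K"
    by (simp add: K_def c_def diag_polar_def psd_dual_def symmetric_matrices_closure)
  have cont: "continuous_on T (dual_objective L)" for T
    unfolding dual_objective_def split_beta by (intro continuous_intros) auto
  have "closed K"
    unfolding K_def
    by (intro closed_Int closed_Times closed_diag_polar closed_psd_dual closed_Collect_le cont
        continuous_on_const)
  moreover have "bounded K"
  proof -
    define r where "r = sqrt (2 * c)"
    have "norm Z \<le> c \<and> norm D \<le> norm L + c + r" if "(D, Z) \<in> K" for D Z
    proof -
      have "Z \<in> psd_dual" and obj: "(norm (L - D - Z))\<^sup>2 / 2 + Z \<bullet> mat 1 \<le> c"
        using that by (auto simp: K_def dual_objective_def)
      then have trace: "norm Z \<le> Z \<bullet> mat 1" by (simp add: psd_dual_norm_le_trace)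
      then have nZ: "norm Z \<le> c" using obj zero_le_power2[of "norm (L - D - Z)"] by linarith
      have "0 \<le> Z \<bullet> mat 1" using trace norm_ge_zero[of Z] by linarith
      then have "(norm (L - D - Z))\<^sup>2 \<le> 2 * c" using obj by linarith
      then have "norm (L - D - Z) \<le> r" unfolding r_def by (rule real_le_rsqrt)
      moreover have "norm D = norm (L - (L - D - Z) - Z)" by simp
      moreover have "\<dots> \<le> norm L + norm (L - D - Z) + norm Z"
        by (meson norm_triangle_ineq4 order_trans add_right_mono)
      ultimately show ?thesis using nZ by linarith
    qed
    then have "K \<subseteq> cball 0 (norm L + c + r) \<times> cball 0 c"
      by (auto simp: mem_cball_0)
    then show ?thesis by (rule bounded_subset[rotated]) (intro bounded_Times bounded_cball)
  qed
  ultimately have "compact K" by (simp add: compact_eq_bounded_closed)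
  then obtain p where p: "p \<in> K" and min: "\<And>q. q \<in> K \<Longrightarrow> dual_objective L p \<le> dual_objective L q"
    using continuous_attains_inf[of K "dual_objective L"] zero cont by blast
  have "dual_objective L p \<le> dual_objective L q" if "q \<in> diag_polar \<times> psd_dual" for q
    using that min[of q] p by (cases "dual_objective L q \<le> c") (auto simp: K_def)
  then show thesis using that[of "fst p" "snd p"] p by (auto simp: K_def)
qed

lemma nonneg_derivativeI:
  fixes a b :: real
  assumes "\<And>t. 0 < t \<Longrightarrow> t \<le> 1 \<Longrightarrow> 0 \<le> t * a + t\<^sup>2 * b"
  shows "0 \<le> a"
proof (rule tendsto_lowerbound)
  have "((\<lambda>t. a + t * b) \<longlongrightarrow> a + 0 * b) (at_right 0)" by (intro tendsto_intros)
  then show "((\<lambda>t. a + t * b) \<longlongrightarrow> a) (at_right 0)" by simp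
  have "0 \<le> a + t * b" if "0 < t" "t < 1" for t
  proof -
    have "0 \<le> t * (a + t * b)"
      using assms[of t] that by (simp add: power2_eq_square distrib_left mult.assoc)
    then show ?thesis using that(1) by (simp add: zero_le_mult_iff)
  qed
  then show "\<forall>\<^sub>F t in at_right 0. 0 \<le> a + t * b"
    unfolding eventually_at_right_field by (intro exI[of _ 1]) auto
qed simp

text \<open>
  The optimality conditions of the dual minimum are exactly the feasibility of \<open>U = L - D - Z\<close> and
  complementary slackness. Increasing \<open>D\<close> by \<open>e\<^sub>i e\<^sub>i\<^sup>T\<close> gives \<open>U\<^sub>i\<^sub>i \<le> 0\<close>, increasing \<open>Z\<close> by \<open>x x\<^sup>T\<close> gives
  \<open>x\<^sup>T (I - U) x \<ge> 0\<close>, and shrinking \<open>D\<close> or \<open>Z\<close> towards zero gives complementarity.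
\<close>

lemma multipliers_exist:
  assumes L: "L \<in> symmetric_matrices"
  obtains U D Z where "U \<in> diag_nonpos" "U \<in> below_identity"
    "D \<in> normal_cone diag_nonpos U" "Z \<in> normal_cone below_identity U" "L = U + D + Z"
proof -
  obtain D Z where D: "D \<in> diag_polar" and Z: "Z \<in> psd_dual" and min:
    "\<And>D' Z'. D' \<in> diag_polar \<Longrightarrow> Z' \<in> psd_dual \<Longrightarrow>
       dual_objective L (D, Z) \<le> dual_objective L (D', Z')"
    using dual_minimum_exists[of L] by blast
  define U where "U = L - D - Z"
  have U: "U \<in> symmetric_matrices"
    using L D Z by (auto simp: U_def diag_polar_def psd_dual_def symmetric_matrices_closure)
  \<comment> \<open>The one-sided derivative of the objective at \<open>(D, Z)\<close> in any feasible direction \<open>(E, Q)\<close>, which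
    equals \<open>\<langle>I - U, Q\<rangle> - \<langle>U, E\<rangle>\<close>, is nonnegative.\<close>
  have slope: "U \<bullet> E \<le> (mat 1 - U) \<bullet> Q"
    if "\<And>t. 0 < t \<Longrightarrow> t \<le> 1 \<Longrightarrow> D + t *\<^sub>R E \<in> diag_polar"
      and "\<And>t. 0 < t \<Longrightarrow> t \<le> 1 \<Longrightarrow> Z + t *\<^sub>R Q \<in> psd_dual" for E Q
  proof -
    have "0 \<le> (mat 1 - U) \<bullet> Q - U \<bullet> E"
    proof (rule nonneg_derivativeI)
      fix t :: real assume "0 < t" "t \<le> 1"
      then have "dual_objective L (D, Z) \<le> dual_objective L (D + t *\<^sub>R E, Z + t *\<^sub>R Q)"
        by (intro min that)
      moreover have "L - (D + t *\<^sub>R E) - (Z + t *\<^sub>R Q) = U - t *\<^sub>R (E + Q)"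
        by (simp add: U_def algebra_simps)
      ultimately have "(norm U)\<^sup>2 / 2 + Z \<bullet> mat 1
          \<le> (norm (U - t *\<^sub>R (E + Q)))\<^sup>2 / 2 + (Z + t *\<^sub>R Q) \<bullet> mat 1"
        by (simp add: dual_objective_def U_def)
      moreover have "(norm (U - t *\<^sub>R (E + Q)))\<^sup>2
          = (norm U)\<^sup>2 - 2 * (t * (U \<bullet> (E + Q))) + t\<^sup>2 * (norm (E + Q))\<^sup>2"
        by (simp add: power2_norm_eq_inner inner_diff_left inner_diff_right inner_commute
            power2_eq_square[of t] right_diff_distrib)
      moreover have "(Z + t *\<^sub>R Q) \<bullet> mat 1 = Z \<bullet> mat 1 + t * (Q \<bullet> mat 1)"
        by (simp add: inner_add_left)
      moreover have "t * ((mat 1 - U) \<bullet> Q - U \<bullet> E) = t * (Q \<bullet> mat 1) - t * (U \<bullet> (E + Q))"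
        by (simp add: inner_diff_left inner_add_right algebra_simps inner_commute)
      ultimately show "0 \<le> t * ((mat 1 - U) \<bullet> Q - U \<bullet> E) + t\<^sup>2 * ((norm (E + Q))\<^sup>2 / 2)"
        by linarith
    qed
    then show ?thesis by simp
  qed
  have D0: "D + t *\<^sub>R 0 \<in> diag_polar" and Z0: "Z + t *\<^sub>R 0 \<in> psd_dual" for t
    using D Z by simp_all
  have shrinkD: "D + t *\<^sub>R (- D) \<in> diag_polar" if "t \<le> 1" for t
    using diag_polar_add_scaleR[of "1 - t" 0 D] that D
    by (simp add: algebra_simps diag_polar_def symmetric_matrices_closure)
  have shrinkZ: "Z + t *\<^sub>R (- Z) \<in> psd_dual" if "t \<le> 1" for t
    using psd_dual_add_scaleR[of "1 - t" 0 Z] that Z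
    by (simp add: algebra_simps psd_dual_def symmetric_matrices_closure)
  have S1: "U \<in> diag_nonpos"
  proof -
    have "U $ i $ i \<le> 0" for i
    proof -
      have "axis i (axis i 1) \<in> symmetric_matrices"
        by (auto simp: symmetric_matrices_def transpose_def vec_eq_iff axis_def)
      then have "axis i (axis i 1) \<in> diag_polar"
        by (simp add: diag_polar_def diag_nonpos_def inner_axis')
      then have "U \<bullet> axis i (axis i 1) \<le> (mat 1 - U) \<bullet> 0"
        using D by (intro slope Z0 diag_polar_add_scaleR) auto
      then show ?thesis by (simp add: inner_axis)
    qed
    then show ?thesis using U by (simp add: diag_nonpos_def)
  qed
  have S2: "U \<in> below_identity"
  proof -
    have "0 \<le> x \<bullet> ((mat 1 - U) *v x)" for x
    proof -
      have "U \<bullet> 0 \<le> (mat 1 - U) \<bullet> outer_square x"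
        using Z by (intro slope D0 psd_dual_add_scaleR outer_square_psd_dual) auto
      then show ?thesis by (simp only: inner_outer_square inner_zero_right)
    qed
    then show ?thesis
      using U by (simp add: below_identity_iff psd_coneI symmetric_matrices_closure mat_1_symmetric)
  qed
  have "U \<bullet> (- D) \<le> (mat 1 - U) \<bullet> 0" by (intro slope shrinkD Z0)
  then have "D \<in> normal_cone diag_nonpos U"
    using D by (auto simp: normal_cone_def diag_polar_def inner_diff_right inner_commute[of U]
        intro: order_trans)
  moreover have "U \<bullet> 0 \<le> (mat 1 - U) \<bullet> (- Z)" by (intro slope shrinkZ D0)
  then have "Z \<in> normal_cone below_identity U"
    using Z by (intro below_identity_normalI) (auto simp: inner_commute)
  moreover have "L = U + D + Z" by (simp add: U_def)
  ultimately show thesis using that S1 S2 by blast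
qed

section \<open>The contraction\<close>

lemma norm_axis_real: "norm (axis i (a :: real)) = \<bar>a\<bar>"
  by (simp add: norm_eq_sqrt_inner inner_axis_axis)

lemma diagonal_norm_le_product:
  fixes W Y :: "real^'n^'n"
  assumes diag: "\<And>i j. i \<noteq> j \<Longrightarrow> W $ i $ j = 0" and Y: "\<And>i. 1 \<le> Y $ i $ i"
  shows "norm W \<le> norm (Y ** W)"
proof (rule power2_le_imp_le)
  have entry: "(Y ** W) $ i $ j = Y $ i $ j * W $ j $ j" for i j
  proof -
    have "(Y ** W) $ i $ j = (\<Sum>k\<in>UNIV. if k = j then Y $ i $ j * W $ j $ j else 0)"
      unfolding matrix_matrix_mult_def vec_lambda_beta using diag by (intro sum.cong) auto
    then show ?thesis by simp
  qed
  have "norm (W $ i) \<le> norm ((Y ** W) $ i)" for i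
  proof -
    have "W $ i = axis i (W $ i $ i)" using diag[of i] by (auto simp: vec_eq_iff axis_def)
    then have "norm (W $ i) = \<bar>W $ i $ i\<bar>" by (metis norm_axis_real)
    also have "\<dots> \<le> \<bar>Y $ i $ i * W $ i $ i\<bar>"
      using mult_right_mono[of 1 "\<bar>Y $ i $ i\<bar>" "\<bar>W $ i $ i\<bar>"] Y[of i] by (simp add: abs_mult)
    also have "\<dots> \<le> norm ((Y ** W) $ i)"
      using component_le_norm_cart[of "(Y ** W) $ i" i] by (simp add: entry)
    finally show ?thesis .
  qed
  then show "(norm W)\<^sup>2 \<le> (norm (Y ** W))\<^sup>2"
    by (simp add: norm_matrix_power2_eq_sum_rows sum_mono power_mono)
qed simp

text \<open>
  Here \<open>(U, Z)\<close> is the limiting pair and \<open>(U', Z')\<close> the outcome of a projection onto \<open>S\<^sub>2\<close>; \<open>W\<close> is the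
  difference of the projected arguments. For general \<open>W\<close> the residual can move as far as the argument
  does, but then \<open>U' = U\<close> and \<open>(I - U) W = 0\<close>. For diagonal \<open>W\<close> this forces \<open>W = 0\<close>, as the diagonal of
  \<open>I - U\<close> is at least \<open>1\<close>; the proof makes this quantitative.
\<close>

lemma psd_residual_contraction:
  fixes U U' Z Z' :: "real^'n^'n"
  defines "W \<equiv> (U' + Z') - (U + Z)"
  assumes U: "U \<in> diag_nonpos" "U \<in> below_identity" and Z: "Z \<in> normal_cone below_identity U"
    and U': "U' \<in> below_identity" and Z': "Z' \<in> normal_cone below_identity U'"
    and diag: "\<And>i j. i \<noteq> j \<Longrightarrow> W $ i $ j = 0"
    and R: "norm Z' \<le> R"
    and C: "C = 2 * norm (mat 1 - U) * (norm (mat 1 - U) + R)"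
  shows "1 < C" "(norm (Z' - Z))\<^sup>2 \<le> (1 - 1 / C) * (norm W)\<^sup>2"
proof -
  define Y where "Y = mat 1 - U"
  define t where "t = Z' \<bullet> Y"
  have Ypsd: "Y \<in> psd_cone" using U(2) by (simp add: Y_def below_identity_iff)
  have Ydiag: "1 \<le> Y $ i $ i" for i
    using U(1) by (simp add: Y_def mat_def diag_nonpos_def)
  have nY: "1 \<le> norm Y"
  proof -
    fix i
    show ?thesis
      using Ydiag[of i] component_le_norm_cart[of "Y $ i" i] Finite_Cartesian_Product.norm_nth_le[of Y i] by linarith
  qed
  have R0: "0 \<le> R" using R norm_ge_zero order_trans by blast
  have C': "C = 2 * norm Y * (norm Y + R)" by (simp add: C Y_def)
  have "2 * (1 * 1) \<le> 2 * (norm Y * (norm Y + R))"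
    using nY R0 by (intro mult_left_mono mult_mono) auto
  then show C1: "1 < C" by (simp add: C' mult.assoc)
  have Zdual: "Z \<in> psd_dual" "Z \<bullet> Y = 0" and Z'dual: "Z' \<in> psd_dual" "Z' \<bullet> (mat 1 - U') = 0"
    using below_identity_normalD Z Z' U(2) U' by (auto simp: Y_def)
  have t0: "0 \<le> t" unfolding t_def by (intro psd_dual_inner Z'dual Ypsd)
  have YZ: "Y ** Z = 0"
    using psd_product_norm_le[OF Ypsd Zdual(1)] Zdual(2) by simp
  have "norm W \<le> norm (Y ** W)" by (rule diagonal_norm_le_product[OF diag Ydiag])
  also have "Y ** W = Y ** Z' + Y ** (U' - U)"
  proof -
    have "Z' + (U' - U) = W + Z" by (simp add: W_def)
    then have "Y ** Z' + Y ** (U' - U) = Y ** W + Y ** Z"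
      by (metis matrix_add_ldistrib)
    then show ?thesis by (simp add: YZ)
  qed
  also have "norm \<dots> \<le> norm (Y ** Z') + norm Y * norm (U' - U)"
    by (intro norm_triangle_le add_mono norm_matrix_matrix_mult_le) simp
  finally have "(norm W)\<^sup>2 \<le> (norm (Y ** Z') + norm Y * norm (U' - U))\<^sup>2"
    by (intro power_mono) auto
  also have "\<dots> \<le> 2 * (norm (Y ** Z'))\<^sup>2 + 2 * (norm Y * norm (U' - U))\<^sup>2"
    by (smt (verit) power2_sum sum_squares_bound)
  also have "\<dots> \<le> 2 * (norm Y * R * t) + 2 * ((norm Y)\<^sup>2 * (norm (U' - U))\<^sup>2)"
  proof -
    have "(norm (Y ** Z'))\<^sup>2 \<le> norm Y * norm Z' * t"
      unfolding t_def by (rule psd_product_norm_le[OF Ypsd Z'dual(1)])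
    also have "\<dots> \<le> norm Y * R * t" by (intro mult_right_mono mult_left_mono R t0) auto
    finally show ?thesis by (simp add: power_mult_distrib)
  qed
  also have "\<dots> \<le> C * (2 * t + (norm (U' - U))\<^sup>2)"
    using nY R0 t0 by (simp add: C' algebra_simps power2_eq_square)
  finally have gap: "(norm W)\<^sup>2 \<le> C * (2 * t + (norm (U' - U))\<^sup>2)" .
  \<comment> \<open>The bracket on the right of \<open>gap\<close> bounds from below what the step loses.\<close>
  have "(Z' - Z) \<bullet> (U' - U) = t + Z \<bullet> (mat 1 - U')"
    using Zdual(2) Z'dual(2) by (simp add: t_def Y_def inner_diff_left inner_diff_right)
  moreover have "0 \<le> Z \<bullet> (mat 1 - U')"
    using U' by (intro psd_dual_inner Zdual) (simp add: below_identity_iff)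
  moreover have "(norm W)\<^sup>2
      = (norm (Z' - Z))\<^sup>2 + (norm (U' - U))\<^sup>2 + 2 * ((Z' - Z) \<bullet> (U' - U))"
    by (simp add: W_def power2_norm_eq_inner algebra_simps inner_commute)
  ultimately have "(norm (Z' - Z))\<^sup>2 \<le> (norm W)\<^sup>2 - (2 * t + (norm (U' - U))\<^sup>2)" by simp
  also have "\<dots> \<le> (norm W)\<^sup>2 - (norm W)\<^sup>2 / C"
  proof -
    have "(norm W)\<^sup>2 / C \<le> 2 * t + (norm (U' - U))\<^sup>2"
      using gap C1 by (simp add: pos_divide_le_eq mult.commute)
    then show ?thesis by simp
  qed
  finally show "(norm (Z' - Z))\<^sup>2 \<le> (1 - 1 / C) * (norm W)\<^sup>2" by (simp add: algebra_simps)
qed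

section \<open>Linear convergence\<close>

text \<open>
  Because \<open>U2 k + Z1 k + Z2 k = L\<close>, the two projected arguments are \<open>L - Z2 k\<close> and \<open>L - Z1 (k+1)\<close>:
  each half step depends on the other multiplier alone. Symmetry of \<open>Z2\<close> has to be carried along, since
  normal vectors are taken among symmetric matrices.
\<close>

lemma dykstra_invariants:
  assumes L: "L \<in> symmetric_matrices"
    and dyk: "dykstra_iterates diag_nonpos below_identity L U1 Z1 U2 Z2"
  shows "Z2 k \<in> symmetric_matrices" "U2 k + Z1 k + Z2 k = L"
    "U1 (Suc k) \<in> diag_nonpos" "Z1 (Suc k) \<in> normal_cone diag_nonpos (U1 (Suc k))"
    "U2 (Suc k) \<in> below_identity" "Z2 (Suc k) \<in> normal_cone below_identity (U2 (Suc k))"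
    "U1 (Suc k) + Z1 (Suc k) + Z2 k = L"
proof -
  note proj1 = closest_point_residual_normal[OF convex_diag_nonpos closed_diag_nonpos]
  note proj2 = closest_point_residual_normal[OF convex_below_identity closed_below_identity]
  have ne: "diag_nonpos \<noteq> {}" "below_identity \<noteq> {}" using zero_feasible by auto
  have sub: "diag_nonpos \<subseteq> symmetric_matrices" "below_identity \<subseteq> symmetric_matrices"
    by (auto simp: diag_nonpos_def below_identity_def)
  have init: "U2 0 = L" "Z1 0 = 0" "Z2 0 = 0"
    and step: "U1 (Suc k) = closest_point diag_nonpos (U2 k + Z1 k)"
      "Z1 (Suc k) = U2 k + Z1 k - U1 (Suc k)"
      "U2 (Suc k) = closest_point below_identity (U1 (Suc k) + Z2 k)"
      "Z2 (Suc k) = U1 (Suc k) + Z2 k - U2 (Suc k)" for k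
    using dyk by (auto simp: dykstra_iterates_def)
  have step1: "U1 (Suc k) \<in> diag_nonpos" "Z1 (Suc k) \<in> normal_cone diag_nonpos (U1 (Suc k))"
    "U1 (Suc k) + Z1 (Suc k) + Z2 k = L"
    if "Z2 k \<in> symmetric_matrices" "U2 k + Z1 k + Z2 k = L" for k
  proof -
    have "U2 k + Z1 k = L - Z2 k" using that(2) by (simp add: algebra_simps)
    then have "U2 k + Z1 k \<in> symmetric_matrices" using that(1) L by (simp add: symmetric_matrices_closure)
    from proj1[OF ne(1) sub(1) this]
    show "U1 (Suc k) \<in> diag_nonpos" "Z1 (Suc k) \<in> normal_cone diag_nonpos (U1 (Suc k))"
      by (simp_all add: step)
    show "U1 (Suc k) + Z1 (Suc k) + Z2 k = L" using that(2) step(2)[of k] by (simp add: algebra_simps)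
  qed
  have step2: "U2 (Suc k) \<in> below_identity" "Z2 (Suc k) \<in> normal_cone below_identity (U2 (Suc k))"
    if "U1 (Suc k) \<in> diag_nonpos" "Z2 k \<in> symmetric_matrices" for k
  proof -
    have "U1 (Suc k) + Z2 k \<in> symmetric_matrices"
      using that sub by (auto intro: symmetric_matrices_closure)
    from proj2[OF ne(2) sub(2) this]
    show "U2 (Suc k) \<in> below_identity" "Z2 (Suc k) \<in> normal_cone below_identity (U2 (Suc k))"
      by (simp_all add: step)
  qed
  have inv: "Z2 k \<in> symmetric_matrices \<and> U2 k + Z1 k + Z2 k = L" for k
  proof (induction k)
    case 0
    then show ?case by (simp add: init symmetric_matrices_closure)
  next
    case (Suc k)
    then have "Z2 (Suc k) \<in> symmetric_matrices"
      using step2 step1 by (auto simp: normal_cone_def)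
    moreover have "U2 (Suc k) + Z1 (Suc k) + Z2 (Suc k) = L"
    proof -
      have "U2 (Suc k) + Z1 (Suc k) + Z2 (Suc k) = U1 (Suc k) + Z1 (Suc k) + Z2 k"
        by (simp add: step(4))
      then show ?thesis using step1(3)[of k] Suc by simp
    qed
    ultimately show ?case by simp
  qed
  then show "Z2 k \<in> symmetric_matrices" "U2 k + Z1 k + Z2 k = L"
    "U1 (Suc k) \<in> diag_nonpos" "Z1 (Suc k) \<in> normal_cone diag_nonpos (U1 (Suc k))"
    "U2 (Suc k) \<in> below_identity" "Z2 (Suc k) \<in> normal_cone below_identity (U2 (Suc k))"
    "U1 (Suc k) + Z1 (Suc k) + Z2 k = L"
    using step1 step2 by blast+
qed

lemma dykstra_converges_linearly:
  assumes L: "L \<in> symmetric_matrices"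
    and dyk: "dykstra_iterates diag_nonpos below_identity L U1 Z1 U2 Z2"
  shows "converges_linearly U2 (closest_point (diag_nonpos \<inter> below_identity) L)"
proof -
  obtain U D Z where U: "U \<in> diag_nonpos" "U \<in> below_identity"
    and D: "D \<in> normal_cone diag_nonpos U" and Z: "Z \<in> normal_cone below_identity U"
    and eq: "L = U + D + Z"
    using multipliers_exist[OF L] by blast
  have "L - U \<in> normal_cone (diag_nonpos \<inter> below_identity) U"
    using D Z by (fastforce simp: eq normal_cone_def symmetric_matrices_closure inner_add_left
        intro: add_nonpos_nonpos)
  then have proj: "closest_point (diag_nonpos \<inter> below_identity) L = U"
    using U by (intro closest_point_eqI convex_Int closed_Int convex_diag_nonpos
        convex_below_identity closed_diag_nonpos closed_below_identity) auto
  note inv = dykstra_invariants[OF L dyk]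
  have init: "Z1 0 = 0" "Z2 0 = 0" using dyk by (auto simp: dykstra_iterates_def)
  define a where "a k = norm (Z2 k - Z)" for k
  have diag_step: "norm (Z1 (Suc k) - D) \<le> a k" for k
  proof -
    have "norm (Z1 (Suc k) - D) \<le> norm ((U1 (Suc k) + Z1 (Suc k)) - (U + D))"
      by (rule residual_nonexpansive[OF inv(3) U(1) inv(4) D])
    also have "(U1 (Suc k) + Z1 (Suc k)) - (U + D) = Z - Z2 k"
      using inv(7)[of k] by (simp add: eq algebra_simps)
    finally show ?thesis by (simp add: a_def norm_minus_commute)
  qed
  have shift: "(U2 (Suc k) + Z2 (Suc k)) - (U + Z) = D - Z1 (Suc k)" for k
    using inv(2)[of "Suc k"] by (simp add: eq algebra_simps)
  have psd_step: "a (Suc k) \<le> norm (Z1 (Suc k) - D)" for k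
    using residual_nonexpansive[OF inv(5)[of k] U(2) inv(6)[of k] Z]
    by (simp add: a_def shift norm_minus_commute)
  have a_le: "a k \<le> norm Z" for k
  proof (induction k)
    case (Suc k)
    then show ?case using diag_step[of k] psd_step[of k] by linarith
  qed (simp add: a_def init)
  \<comment> \<open>By \<open>a_le\<close>, all \<open>Z2 k\<close> have norm at most \<open>2 \<parallel>Z\<parallel>\<close>, so one constant serves every step.\<close>
  define C where "C = 2 * norm (mat 1 - U) * (norm (mat 1 - U) + 2 * norm Z)"
  have contr: "1 < C" "(a (Suc k))\<^sup>2 \<le> (1 - 1 / C) * (norm (Z1 (Suc k) - D))\<^sup>2" for k
  proof -
    have "norm (Z2 (Suc k)) \<le> 2 * norm Z"
      using a_le[of "Suc k"] norm_triangle_sub[of "Z2 (Suc k)" Z] by (simp add: a_def)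
    moreover have "((U2 (Suc k) + Z2 (Suc k)) - (U + Z)) $ i $ j = 0" if "i \<noteq> j" for i j
      using diag_nonpos_normal_off_diagonal[OF D U(1) that]
        diag_nonpos_normal_off_diagonal[OF inv(4,3) that] by (simp add: shift)
    ultimately show "1 < C" "(a (Suc k))\<^sup>2 \<le> (1 - 1 / C) * (norm (Z1 (Suc k) - D))\<^sup>2"
      using psd_residual_contraction[OF U Z inv(5,6), of k "2 * norm Z" C]
      by (simp_all add: C_def a_def shift norm_minus_commute)
  qed
  define \<rho> where "\<rho> = sqrt (1 - 1 / C)"
  have \<rho>: "0 < \<rho>" "\<rho> < 1" "\<rho>\<^sup>2 = 1 - 1 / C"
    using contr(1) by (auto simp: \<rho>_def)
  have a_Suc: "a (Suc k) \<le> \<rho> * a k" for k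
  proof (rule power2_le_imp_le)
    have "(a (Suc k))\<^sup>2 \<le> \<rho>\<^sup>2 * (norm (Z1 (Suc k) - D))\<^sup>2" using contr(2) by (simp add: \<rho>(3))
    also have "\<dots> \<le> \<rho>\<^sup>2 * (a k)\<^sup>2"
      by (intro mult_left_mono power_mono diag_step) auto
    finally show "(a (Suc k))\<^sup>2 \<le> (\<rho> * a k)\<^sup>2" by (simp add: power_mult_distrib)
    show "0 \<le> \<rho> * a k" using \<rho> by (simp add: a_def)
  qed
  have a_rate: "a k \<le> norm Z * \<rho> ^ k" for k
  proof (induction k)
    case (Suc k)
    then have "\<rho> * a k \<le> \<rho> * (norm Z * \<rho> ^ k)" using \<rho> by (intro mult_left_mono) auto
    then show ?case using a_Suc[of k] by (simp add: mult_ac)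
  qed (simp add: a_def init)
  \<comment> \<open>The error of \<open>Z1\<close> lags one step behind that of \<open>Z2\<close>, hence the division by \<open>\<rho>\<close>; the first
    summand accounts for \<open>Z1 0 = 0\<close>.\<close>
  have d_rate: "norm (Z1 k - D) \<le> (norm D + norm Z / \<rho>) * \<rho> ^ k" for k
  proof (cases k)
    case 0
    then show ?thesis using \<rho> by (simp add: init)
  next
    case (Suc j)
    have "norm (Z1 k - D) \<le> norm Z * \<rho> ^ j" using diag_step[of j] a_rate[of j] Suc by simp
    also have "\<dots> = norm Z / \<rho> * \<rho> ^ k" using \<rho> by (simp add: Suc)
    also have "\<dots> \<le> (norm D + norm Z / \<rho>) * \<rho> ^ k" using \<rho> by (intro mult_right_mono) auto
    finally show ?thesis .
  qed
  have "norm (U2 k - U) \<le> (norm D + norm Z / \<rho> + norm Z) * \<rho> ^ k" for k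
  proof -
    have "U2 k - U = (D - Z1 k) + (Z - Z2 k)"
      using inv(2)[of k] by (simp add: eq algebra_simps)
    then have "norm (U2 k - U) \<le> norm (Z1 k - D) + norm (Z2 k - Z)"
      by (metis norm_minus_commute norm_triangle_ineq)
    then show ?thesis using d_rate[of k] a_rate[of k] by (simp add: a_def distrib_right)
  qed
  then show ?thesis
    unfolding proj converges_linearly_def using \<rho> by blast
qed

theorem proposition2p6:
  fixes Lbar Lstar :: "real^'n^'n"
    and U1 Z1 U2 Z2 :: "nat \<Rightarrow> real^'n^'n"
  assumes "Lbar \<in> symmetric_matrices"
    and "Lstar = closest_point (diag_nonpos \<inter> below_identity) Lbar"
    and "Lbar - Lstar \<in> rel_interior (normal_cone (diag_nonpos \<inter> below_identity) Lstar)"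
    and "dykstra_iterates diag_nonpos below_identity Lbar U1 Z1 U2 Z2"
  shows "converges_linearly U2 Lstar"
  using dykstra_converges_linearly[OF assms(1,4)] by (simp add: assms(2))

end
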